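(* For $n\ge1$ let \[ P_{n}(y,z,s,t)=P_{n}^{(\mathrm{lpk},\mathrm{ilpk},\mathrm{des},\mathrm{ides})}(y,z,s,t)=\sum_{\pi\in\mathfrak{S}_{n}}y^{\mathrm{lpk}(\pi)}z^{\mathrm{ilpk}(\pi)}s^{\mathrm{des}(\pi)}t^{\mathrm{ides}(\pi)}. \] Then, as formal power series, \begin{multline*} \frac{1}{(1-s)(1-t)}+\sum_{n=1}^{\infty}\frac{(1+ys)^{n}(1+zt)^{n}P_{n}\left(\frac{(1+y)^{2}s}{(y+s)(1+ys)},\frac{(1+z)^{2}t}{(z+t)(1+zt)},\frac{y+s}{1+ys},\frac{z+t}{1+zt}\right)}{(1-s)^{n+1}(1-t)^{n+1}}x^{n}\\ =\sum_{i,j=0}^{\infty}\frac{(1+yx)^{i(j+1)}(1+zx)^{(i+1)j}}{(1-yzx)^{ij}(1-x)^{(i+1)(j+1)}}s^{i}t^{j}. \end{multline*}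
   Context: $\mathfrak{S}_n$ is the symmetric group on $[n]$. For $\pi\in\mathfrak{S}_n$: $i\in[n-1]$ is a descent if $\pi(i)>\pi(i+1)$ and $\mathrm{des}(\pi)$ is the number of descents; $i$ with $2\le i\le n-1$ is a peak if $\pi(i-1)<\pi(i)>\pi(i+1)$; $i\in[n-1]$ is a left peak if $i$ is a peak, or if $i=1$ and $\pi(1)>\pi(2)$; $\mathrm{lpk}(\pi)$ is the number of left peaks. Inverse statistics are $\mathrm{ides}(\pi)=\mathrm{des}(\pi^{-1})$, $\mathrm{ilpk}(\pi)=\mathrm{lpk}(\pi^{-1})$. *)

theory Defs
  imports "HOL-Computational_Algebra.Computational_Algebra" "HOL-Combinatorics.Combinatorics"
begin

text \<open>
  The elements of the symmetric group on \<open>{1..n}\<close> are the functions \<open>\<pi> :: nat \<Rightarrow> nat\<close> with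
  \<open>\<pi> permutes {1..n}\<close>; the inverse permutation is \<open>inv \<pi>\<close>.
\<close>

definition is_descent :: "nat \<Rightarrow> (nat \<Rightarrow> nat) \<Rightarrow> nat \<Rightarrow> bool" where
  "is_descent n \<pi> i \<longleftrightarrow> i \<in> {1..n-1} \<and> \<pi> i > \<pi> (i + 1)"

definition is_peak :: "nat \<Rightarrow> (nat \<Rightarrow> nat) \<Rightarrow> nat \<Rightarrow> bool" where
  "is_peak n \<pi> i \<longleftrightarrow> i \<in> {2..n-1} \<and> \<pi> (i - 1) < \<pi> i \<and> \<pi> i > \<pi> (i + 1)"

definition is_left_peak :: "nat \<Rightarrow> (nat \<Rightarrow> nat) \<Rightarrow> nat \<Rightarrow> bool" where
  "is_left_peak n \<pi> i \<longleftrightarrow> i \<in> {1..n-1} \<and> (is_peak n \<pi> i \<or> (i = 1 \<and> \<pi> 1 > \<pi> 2))"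

definition des :: "nat \<Rightarrow> (nat \<Rightarrow> nat) \<Rightarrow> nat" where
  "des n \<pi> = card {i. is_descent n \<pi> i}"

definition lpk :: "nat \<Rightarrow> (nat \<Rightarrow> nat) \<Rightarrow> nat" where
  "lpk n \<pi> = card {i. is_left_peak n \<pi> i}"

definition ides :: "nat \<Rightarrow> (nat \<Rightarrow> nat) \<Rightarrow> nat" where
  "ides n \<pi> = des n (inv \<pi>)"

definition ilpk :: "nat \<Rightarrow> (nat \<Rightarrow> nat) \<Rightarrow> nat" where
  "ilpk n \<pi> = lpk n (inv \<pi>)"

definition lpk_des_poly :: "nat \<Rightarrow> 'a \<Rightarrow> 'a \<Rightarrow> 'a \<Rightarrow> 'a \<Rightarrow> 'a::comm_semiring_1" where
  "lpk_des_poly n y z s t =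
     (\<Sum>\<pi> | \<pi> permutes {1..n}. y ^ lpk n \<pi> * z ^ ilpk n \<pi> * s ^ des n \<pi> * t ^ ides n \<pi>)"


text \<open>
  The ambient ring is \<open>\<rat>(y,z)[[s]][[t]][[x]]\<close>: formal power series in \<open>s\<close>, \<open>t\<close>, \<open>x\<close> over the
  field of rational functions in \<open>y\<close> and \<open>z\<close>. Since \<open>y\<close> and \<open>z\<close> are invertible, so are \<open>y + s\<close>
  and \<open>z + t\<close>, which occur as denominators (they are not units in \<open>\<rat>[[y,z,s,t,x]]\<close>).
  The coefficient of \<open>x^a t^b s^c\<close> in \<open>f\<close> is \<open>f $ a $ b $ c\<close>.
\<close>

type_synonym ratfun2 = "rat poly poly fract"
type_synonym series = "ratfun2 fps fps fps"

definition var_y :: series where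
  "var_y = fps_const (fps_const (fps_const (to_fract [:[:0, 1:]:])))"

definition var_z :: series where
  "var_z = fps_const (fps_const (fps_const (to_fract [:0, 1:])))"

definition var_s :: series where
  "var_s = fps_const (fps_const fps_X)"

definition var_t :: series where
  "var_t = fps_const fps_X"

definition var_x :: series where
  "var_x = fps_X"


text \<open>
  Infinite sums of formal power series in all three variables simultaneously. (The library's
  topology on \<open>'a fps fps fps\<close> only sees the outermost variable, so \<open>\<Sum>i. s^i\<close> diverges there.)
  A family is summable if every monomial occurs in only finitely many members; the sum is then
  taken coefficientwise.
\<close>

definition fps3_summable :: "('i \<Rightarrow> 'a::comm_monoid_add fps fps fps) \<Rightarrow> 'i set \<Rightarrow> bool" where
  "fps3_summable f A \<longleftrightarrow> (\<forall>a b c. finite {k \<in> A. f k $ a $ b $ c \<noteq> 0})"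

definition fps3_sum :: "('i \<Rightarrow> 'a::comm_monoid_add fps fps fps) \<Rightarrow> 'i set \<Rightarrow> 'a fps fps fps" where
  "fps3_sum f A = Abs_fps (\<lambda>a. Abs_fps (\<lambda>b. Abs_fps (\<lambda>c.
     \<Sum>k \<in> {k \<in> A. f k $ a $ b $ c \<noteq> 0}. f k $ a $ b $ c)))"


text \<open>
  Division in nested power series rings is total; it is genuine division by units, i.e. by series
  with nonzero constant term, and the denominators used are of this form.
\<close>

lemma fps3_mult_inverse:
  fixes g :: "'a::field fps fps fps"
  assumes "g $ 0 $ 0 $ 0 \<noteq> 0"
  shows "g * inverse g = 1"
proof -
  have 1: "g $ 0 $ 0 * inverse (g $ 0 $ 0) = 1"
    using assms inverse_mult_eq_1' by blast
  have 2: "g $ 0 * inverse (g $ 0) = 1"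
    unfolding fps_inverse_def[of "g $ 0"] by (rule fps_right_inverse) (use 1 in simp)
  show ?thesis
    unfolding fps_inverse_def[of g] by (rule fps_right_inverse) (use 2 in simp)
qed

lemma fps3_divide_unit:
  fixes f g :: "'a::field fps fps fps"
  assumes "g $ 0 $ 0 $ 0 \<noteq> 0"
  shows "f / g = f * inverse g"
proof -
  have "g $ 0 \<noteq> 0" using assms by auto
  then have "subdegree g = 0" by (simp add: subdegree_eq_0)
  then show ?thesis by (simp add: fps_divide_def)
qed

lemma denominators_units:
  "(1 - var_s) $ 0 $ 0 $ 0 \<noteq> 0" "(1 - var_t) $ 0 $ 0 $ 0 \<noteq> 0"
  "(1 + var_y * var_s) $ 0 $ 0 $ 0 \<noteq> 0" "(1 + var_z * var_t) $ 0 $ 0 $ 0 \<noteq> 0"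
  "(var_y + var_s) $ 0 $ 0 $ 0 \<noteq> 0" "(var_z + var_t) $ 0 $ 0 $ 0 \<noteq> 0"
  "(1 - var_y * var_z * var_x) $ 0 $ 0 $ 0 \<noteq> 0" "(1 - var_x) $ 0 $ 0 $ 0 \<noteq> 0"
  by (simp_all add: var_y_def var_z_def var_s_def var_t_def var_x_def)

end

theory Submission
  imports Defs
begin

text \<open>
  Take the alphabet \<open>0 < 1' < 1 < 2' < 2 < \<dots> < i' < i\<close> with a factor \<open>y\<close> for every barred
  letter \<open>c'\<close>. For a permutation \<open>\<pi>\<close> consider the weakly increasing words \<open>a\<^sub>1 \<le> \<dots> \<le> a\<^sub>n\<close> in
  which \<open>a\<^sub>k = a\<^sub>k\<^sub>+\<^sub>1\<close> is allowed for an unbarred letter only if \<open>k\<close> is an ascent of \<open>\<pi>\<close>, and for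
  a barred letter only if \<open>k\<close> is a descent. Weighting their number by \<open>s\<^sup>i\<close> and summing over \<open>i\<close>
  gives \<open>(1 + ys)\<^sup>n / (1 - s)\<^sup>n\<^sup>+\<^sup>1\<close> times the monomial of \<open>\<pi>\<close> in \<open>P\<^sub>n\<close> with the substituted
  arguments: by a recursion in \<open>n\<close>, an ascent contributes \<open>1 + ys\<close>, a descent after a descent
  \<open>y + s\<close>, and a descent after an ascent \<open>(1 + y)\<^sup>2 s / (1 + ys)\<close>, up to the factor
  \<open>1 / (1 - s)\<close>.

  It remains to sum the product of these counts for \<open>\<pi>\<close> and \<open>\<pi>\<^sup>-\<^sup>1\<close> over all \<open>\<pi>\<close>. Standardization
  turns a pair of \<open>\<pi>\<close> and an admissible word for \<open>\<pi>\<^sup>-\<^sup>1\<close> into an arbitrary word \<open>w\<close> over the second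
  alphabet. An admissible word for \<open>\<pi>\<close> then cuts \<open>w\<close> into consecutive blocks, one for each
  letter of the first alphabet, that are increasing or decreasing according to the type of the
  letter. The generating function is therefore a product over pairs of letters, with factor
  \<open>1 / (1 - cx)\<close> for letters of the same type and \<open>1 + cx\<close> for letters of different type, where
  \<open>c\<close> is the product of the two weights.
\<close>

section \<open>Words over a signed alphabet\<close>

definition words :: "nat \<Rightarrow> nat \<Rightarrow> nat list set" where
  "words m n = {w. set w \<subseteq> {..<m} \<and> length w = n}"

definition word_weight :: "(nat \<Rightarrow> 'a::comm_monoid_mult) \<Rightarrow> nat list \<Rightarrow> 'a" where
  "word_weight x w = prod_list (map x w)"

lemma finite_words [simp]: "finite (words m n)"
  unfolding words_def by (rule finite_lists_length_eq) simp

lemma words_length: "w \<in> words m n \<Longrightarrow> length w = n"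
  by (simp add: words_def)

lemma words_0_right [simp]: "words m 0 = {[]}"
  by (auto simp: words_def)

lemma words_0_left [simp]: "words 0 (Suc n) = {}"
  by (auto simp: words_def)

lemma word_weight_simps [simp]:
  "word_weight x [] = 1"
  "word_weight x (c # w) = x c * word_weight x w"
  "word_weight x (u @ v) = word_weight x u * word_weight x v"
  "word_weight x (rev w) = word_weight x w"
  by (simp_all add: word_weight_def prod_list.rev flip: rev_map)

lemma word_weight_permute_list:
  assumes "p permutes {..<length w}"
  shows "word_weight x (permute_list p w) = word_weight x w"
  using assms by (simp add: word_weight_def flip: prod_mset_prod_list)

lemma permute_list_in_words:
  assumes "p permutes {..<length w}" "w \<in> words m n"
  shows "permute_list p w \<in> words m n"
  using assms by (simp add: words_def)

text \<open>
  The letters are natural numbers, of which those with \<open>\<epsilon> c\<close> are barred. A set \<open>D\<close> of positions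
  is a predicate, and position \<open>k\<close> lies between the \<open>k\<close>-th and the next letter, whose list
  indices are \<open>k - 1\<close> and \<open>k\<close>.
\<close>

definition compatible :: "(nat \<Rightarrow> bool) \<Rightarrow> (nat \<Rightarrow> bool) \<Rightarrow> nat list \<Rightarrow> bool" where
  "compatible \<epsilon> D a \<longleftrightarrow>
     (\<forall>k. Suc k < length a \<longrightarrow> a ! k < a ! Suc k \<or> a ! k = a ! Suc k \<and> D (Suc k) = \<epsilon> (a ! k))"

definition compatible_words :: "(nat \<Rightarrow> bool) \<Rightarrow> (nat \<Rightarrow> bool) \<Rightarrow> nat \<Rightarrow> nat \<Rightarrow> nat list set" where
  "compatible_words \<epsilon> D m n = {a \<in> words m n. compatible \<epsilon> D a}"

lemma compatible_Nil [simp]: "compatible \<epsilon> D []"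
  by (simp add: compatible_def)

lemma compatible_snoc:
  "compatible \<epsilon> D (a @ [c]) \<longleftrightarrow> compatible \<epsilon> D a \<and>
     (a \<noteq> [] \<longrightarrow> last a < c \<or> last a = c \<and> D (length a) = \<epsilon> c)"
proof (cases a rule: rev_cases)
  case (snoc b d)
  then show ?thesis
    by (auto simp: compatible_def nth_append less_Suc_eq all_conj_distrib imp_conjR)
qed (simp add: compatible_def)

lemma compatible_cong:
  assumes "\<And>k. Suc k < length a \<Longrightarrow> D (Suc k) = D' (Suc k)"
  shows "compatible \<epsilon> D a \<longleftrightarrow> compatible \<epsilon> D' a"
  using assms by (auto simp: compatible_def)

lemma compatible_sorted:
  assumes "compatible \<epsilon> D a"
  shows "sorted a"
  using assms by (auto simp: compatible_def sorted_iff_nth_Suc intro: less_imp_le)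

lemma finite_compatible_words [simp]: "finite (compatible_words \<epsilon> D m n)"
  by (simp add: compatible_words_def)

lemma compatible_words_0_right [simp]: "compatible_words \<epsilon> D m 0 = {[]}"
  by (auto simp: compatible_words_def)

lemma compatible_words_last_less:
  assumes "a \<noteq> []"
  shows "a \<in> compatible_words \<epsilon> D m n \<longleftrightarrow> a \<in> compatible_words \<epsilon> D (Suc m) n \<and> last a < m"
proof -
  have "set a \<subseteq> {..<m} \<longleftrightarrow> set a \<subseteq> {..<Suc m} \<and> last a < m" if "compatible \<epsilon> D a"
  proof -
    obtain b c where a: "a = b @ [c]" using assms by (metis rev_exhaust)
    then show ?thesis using compatible_sorted[OF that] by (fastforce simp: sorted_append)
  qed
  then show ?thesis by (auto simp: compatible_words_def words_def)
qed

lemma snoc_top_in_compatible_words: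
  "a @ [m] \<in> compatible_words \<epsilon> D (Suc m) (Suc n) \<longleftrightarrow>
     a \<in> compatible_words \<epsilon> D (if D n = \<epsilon> m then Suc m else m) n"
proof (cases "a = []")
  case True
  then show ?thesis by (auto simp: compatible_words_def words_def compatible_def)
next
  case False
  have "a @ [m] \<in> compatible_words \<epsilon> D (Suc m) (Suc n) \<longleftrightarrow>
      a \<in> compatible_words \<epsilon> D (Suc m) n \<and> (last a < m \<or> last a = m \<and> D n = \<epsilon> m)"
    using False by (auto simp: compatible_words_def words_def compatible_snoc)
  moreover have "last a \<le> m" if "a \<in> compatible_words \<epsilon> D (Suc m) n"
    using that last_in_set[OF False] by (auto simp: compatible_words_def words_def)
  ultimately show ?thesis
    by (auto simp: compatible_words_last_less[OF False, of _ _ m] le_less)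
qed

lemma compatible_words_Suc:
  "compatible_words \<epsilon> D (Suc m) (Suc n) = compatible_words \<epsilon> D m (Suc n) \<union>
     (\<lambda>a. a @ [m]) ` compatible_words \<epsilon> D (if D n = \<epsilon> m then Suc m else m) n"
    (is "?L = ?R \<union> ?f ` ?S")
proof (intro equalityI subsetI)
  fix a assume a: "a \<in> ?L"
  then obtain b c where bc: "a = b @ [c]" "c \<le> m"
    by (cases a rule: rev_cases) (auto simp: compatible_words_def words_def)
  show "a \<in> ?R \<union> ?f ` ?S"
  proof (cases "c = m")
    case True
    then have "b \<in> ?S" using a by (simp only: bc snoc_top_in_compatible_words)
    then show ?thesis using bc True by blast
  next
    case False
    then show ?thesis using a bc compatible_words_last_less[of a \<epsilon> D m "Suc n"] by simp
  qed
next
  fix a assume "a \<in> ?R \<union> ?f ` ?S"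
  then show "a \<in> ?L"
  proof
    assume a: "a \<in> ?R"
    then have "a \<noteq> []" by (auto simp: compatible_words_def words_def)
    then show ?thesis using a compatible_words_last_less by blast
  next
    assume "a \<in> ?f ` ?S"
    then show ?thesis using snoc_top_in_compatible_words by blast
  qed
qed

text \<open>
  This is Gessel's fundamental quasisymmetric function of the descent set \<open>D\<close>, in its super
  version, with the variable \<open>x c\<close> for the letter \<open>c < m\<close>.
\<close>

definition super_fundamental ::
  "(nat \<Rightarrow> 'a::comm_semiring_1) \<Rightarrow> (nat \<Rightarrow> bool) \<Rightarrow> (nat \<Rightarrow> bool) \<Rightarrow> nat \<Rightarrow> nat \<Rightarrow> 'a" where
  "super_fundamental x \<epsilon> D m n = (\<Sum>a\<in>compatible_words \<epsilon> D m n. word_weight x a)"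

lemma super_fundamental_0_right [simp]: "super_fundamental x \<epsilon> D m 0 = 1"
  by (simp add: super_fundamental_def)

lemma super_fundamental_0_left [simp]: "super_fundamental x \<epsilon> D 0 (Suc n) = 0"
  by (simp add: super_fundamental_def compatible_words_def)

lemma super_fundamental_Suc:
  "super_fundamental x \<epsilon> D (Suc m) (Suc n) = super_fundamental x \<epsilon> D m (Suc n)
     + x m * super_fundamental x \<epsilon> D (if D n = \<epsilon> m then Suc m else m) n"
proof -
  let ?S = "compatible_words \<epsilon> D (if D n = \<epsilon> m then Suc m else m) n"
  let ?f = "\<lambda>a. a @ [m]"
  have "compatible_words \<epsilon> D m (Suc n) \<inter> ?f ` ?S = {}"
    by (auto simp: compatible_words_def words_def)
  then have "super_fundamental x \<epsilon> D (Suc m) (Suc n)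
      = super_fundamental x \<epsilon> D m (Suc n) + (\<Sum>a\<in>?f ` ?S. word_weight x a)"
    unfolding super_fundamental_def compatible_words_Suc by (intro sum.union_disjoint) simp_all
  also have "(\<Sum>a\<in>?f ` ?S. word_weight x a) = (\<Sum>a\<in>?S. x m * word_weight x a)"
    by (subst sum.reindex) (auto simp: inj_on_def mult.commute)
  finally show ?thesis by (simp add: super_fundamental_def sum_distrib_left)
qed

lemma super_fundamental_cong:
  assumes "\<And>k. Suc k < n \<Longrightarrow> D (Suc k) = D' (Suc k)"
  shows "super_fundamental x \<epsilon> D m n = super_fundamental x \<epsilon> D' m n"
proof -
  have "compatible_words \<epsilon> D m n = compatible_words \<epsilon> D' m n"
    using compatible_cong[of _ D D'] assms unfolding compatible_words_def words_def by blast
  then show ?thesis by (simp add: super_fundamental_def)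
qed

lemma super_fundamental_top_block:
  "super_fundamental x \<epsilon> D (Suc m) n = (\<Sum>k\<le>n. if \<forall>l\<in>{k<..<n}. D l = \<epsilon> m
      then x m ^ (n - k) * super_fundamental x \<epsilon> D m k else 0)"
proof (induction n)
  case (Suc n)
  let ?T = "\<lambda>n k. if \<forall>l\<in>{k<..<n}. D l = \<epsilon> m
      then x m ^ (n - k) * super_fundamental x \<epsilon> D m k else 0"
  have shorter: "?T (Suc n) k = (if D n = \<epsilon> m then x m * ?T n k else 0)" if "k < n" for k
  proof -
    have "{k<..<Suc n} = insert n {k<..<n}" using that by auto
    moreover have "Suc n - k = Suc (n - k)" using that by simp
    ultimately show ?thesis by (simp add: mult.assoc)
  qed
  have "(\<Sum>k\<le>Suc n. ?T (Suc n) k) = (\<Sum>k<n. ?T (Suc n) k)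
      + x m * super_fundamental x \<epsilon> D m n + super_fundamental x \<epsilon> D m (Suc n)"
    by (auto simp: Suc_diff_le simp flip: lessThan_Suc_atMost)
  also have "(\<Sum>k<n. ?T (Suc n) k) = (if D n = \<epsilon> m then x m * (\<Sum>k<n. ?T n k) else 0)"
    using shorter by (simp add: sum_distrib_left)
  finally have "(\<Sum>k\<le>Suc n. ?T (Suc n) k) = (if D n = \<epsilon> m then x m * (\<Sum>k<n. ?T n k) else 0)
      + x m * super_fundamental x \<epsilon> D m n + super_fundamental x \<epsilon> D m (Suc n)" .
  moreover have "super_fundamental x \<epsilon> D (Suc m) n = (\<Sum>k<n. ?T n k) + super_fundamental x \<epsilon> D m n"
    unfolding Suc.IH by (simp flip: lessThan_Suc_atMost)
  ultimately show ?case by (simp add: super_fundamental_Suc algebra_simps)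
qed simp

section \<open>Standardization\<close>

lemma permutes_eq_card_less:
  assumes p: "p permutes {..<n}" and k: "k < n"
  shows "p k = card {l. l < n \<and> p l < p k}"
proof -
  have "p k < n" using permutes_in_image[OF p] k by auto
  then have "{..<p k} \<subseteq> p ` {..<n}" by (simp add: permutes_image[OF p])
  then have "p ` {l. l < n \<and> p l < p k} = {..<p k}" by fastforce
  then have "card {..<p k} = card {l. l < n \<and> p l < p k}"
    using permutes_inj[OF p] by (metis card_image inj_on_subset subset_UNIV)
  then show ?thesis by simp
qed

definition order_rank :: "(nat \<Rightarrow> nat \<Rightarrow> bool) \<Rightarrow> nat \<Rightarrow> nat \<Rightarrow> nat" where
  "order_rank R n k = (if k < n then card {l. l < n \<and> R l k} else k)"

context
  fixes R :: "nat \<Rightarrow> nat \<Rightarrow> bool" and n :: nat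
  assumes irrefl: "irreflp R" and trans: "transp R" and total: "totalp R"
begin

lemma order_rank_less_iff:
  assumes "k < n" "l < n"
  shows "order_rank R n k < order_rank R n l \<longleftrightarrow> R k l"
proof -
  have less: "order_rank R n i < order_rank R n j" if "i < n" "j < n" "R i j" for i j
  proof -
    have "{h. h < n \<and> R h i} \<subset> {h. h < n \<and> R h j}"
      using that irrefl transpD[OF trans] by (auto dest: irreflpD)
    then show ?thesis using that by (auto simp: order_rank_def intro: psubset_card_mono)
  qed
  then show ?thesis using assms totalpD[OF total, of k l] by (metis less_asym)
qed

lemma order_rank_permutes: "order_rank R n permutes {..<n}"
proof (rule inj_imp_permutes)
  show "inj_on (order_rank R n) {..<n}"
    using order_rank_less_iff totalpD[OF total] by (intro inj_onI) (metis lessThan_iff less_irrefl)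
  show "order_rank R n k \<in> {..<n}" if k: "k \<in> {..<n}" for k
  proof -
    have "{l. l < n \<and> R l k} \<subset> {..<n}" using k irrefl by (auto dest: irreflpD)
    from psubset_card_mono[OF finite_lessThan this] k show ?thesis by (simp add: order_rank_def)
  qed
qed (auto simp: order_rank_def)

lemma order_rank_unique:
  assumes p: "p permutes {..<n}" and "\<And>k l. k < n \<Longrightarrow> l < n \<Longrightarrow> p k < p l \<Longrightarrow> R k l"
  shows "p = order_rank R n"
proof
  fix k show "p k = order_rank R n k"
  proof (cases "k < n")
    case True
    have "p l < p k \<longleftrightarrow> R l k" if "l < n" for l
      using assms that True irrefl transpD[OF trans] permutes_inj[OF p]
      by (metis injD irreflpD linorder_neqE_nat)
    then have "{l. l < n \<and> p l < p k} = {l. l < n \<and> R l k}" by blast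
    then show ?thesis using permutes_eq_card_less[OF p True] True by (simp add: order_rank_def)
  next
    case False
    then show ?thesis using permutes_not_in[OF p] by (simp add: order_rank_def)
  qed
qed

end

definition precedes :: "(nat \<Rightarrow> bool) \<Rightarrow> nat list \<Rightarrow> nat \<Rightarrow> nat \<Rightarrow> bool" where
  "precedes \<epsilon> w k l \<longleftrightarrow> w ! k < w ! l \<or> w ! k = w ! l \<and> (if \<epsilon> (w ! k) then l < k else k < l)"

definition standardize :: "(nat \<Rightarrow> bool) \<Rightarrow> nat list \<Rightarrow> nat \<Rightarrow> nat" where
  "standardize \<epsilon> w = order_rank (precedes \<epsilon> w) (length w)"

lemma strict_linear_order_precedes:
  "irreflp (precedes \<epsilon> w)" "transp (precedes \<epsilon> w)" "totalp (precedes \<epsilon> w)"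
  by (auto simp: precedes_def irreflp_def transp_def totalp_on_def split: if_splits)

lemma standardize_permutes: "standardize \<epsilon> w permutes {..<length w}"
  unfolding standardize_def by (intro order_rank_permutes strict_linear_order_precedes)

lemma standardize_less_iff:
  assumes "k < length w" "l < length w"
  shows "standardize \<epsilon> w k < standardize \<epsilon> w l \<longleftrightarrow> precedes \<epsilon> w k l"
  unfolding standardize_def by (intro order_rank_less_iff strict_linear_order_precedes assms)

text \<open>
  As \<open>0 - 1 = 0\<close>, position \<open>0\<close> is not a descent of a permutation. It may be one of a word, but a
  word has no position \<open>0\<close>.
\<close>

definition perm_descent :: "(nat \<Rightarrow> nat) \<Rightarrow> nat \<Rightarrow> bool" where
  "perm_descent p k \<longleftrightarrow> p k < p (k - 1)"

definition word_descent :: "(nat \<Rightarrow> bool) \<Rightarrow> nat list \<Rightarrow> nat \<Rightarrow> bool" where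
  "word_descent \<epsilon> w k \<longleftrightarrow> w ! k < w ! (k - 1) \<or> w ! k = w ! (k - 1) \<and> \<epsilon> (w ! k)"

lemma perm_descent_standardize:
  assumes "Suc k < length w"
  shows "perm_descent (standardize \<epsilon> w) (Suc k) \<longleftrightarrow> word_descent \<epsilon> w (Suc k)"
  using assms by (auto simp: perm_descent_def standardize_less_iff precedes_def word_descent_def)

lemma compatible_permute_list:
  assumes q: "q permutes {..<length w}"
  shows "compatible \<epsilon> (perm_descent q) (permute_list q w) \<longleftrightarrow>
     (\<forall>k. Suc k < length w \<longrightarrow> precedes \<epsilon> w (q k) (q (Suc k)))"
proof -
  have "q k \<noteq> q (Suc k)" for k using permutes_inj[OF q] by (simp add: inj_eq)
  then show ?thesis
    unfolding compatible_def precedes_def perm_descent_def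
    by (auto simp: permute_list_nth[OF q] neq_iff split: if_splits)
qed

lemma standardize_eq_iff:
  assumes p: "p permutes {..<length w}"
  shows "standardize \<epsilon> w = p \<longleftrightarrow>
     compatible \<epsilon> (perm_descent (inv p)) (permute_list (inv p) w)"
    (is "_ \<longleftrightarrow> ?compatible")
proof
  assume std: "standardize \<epsilon> w = p"
  have inv_less: "inv p k < length w" if "k < length w" for k
    using permutes_in_image[OF permutes_inv[OF p]] that by auto
  have "precedes \<epsilon> w (inv p k) (inv p (Suc k))" if "Suc k < length w" for k
    using that inv_less standardize_less_iff[of "inv p k" w "inv p (Suc k)" \<epsilon>]
    by (simp add: std permutes_inverses(1)[OF p])
  then show ?compatible by (simp add: compatible_permute_list[OF permutes_inv[OF p]])
next
  assume compatible: ?compatible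
  have "j < length w \<longrightarrow> precedes \<epsilon> w (inv p i) (inv p j)" if "i < j" for i j
    using that
  proof (induction rule: less_Suc_induct)
    case (1 i)
    then show ?case using compatible by (simp add: compatible_permute_list[OF permutes_inv[OF p]])
  next
    case (2 i j k)
    then show ?case using strict_linear_order_precedes(2)[THEN transpD] by (meson less_trans)
  qed
  then have "precedes \<epsilon> w k l" if "k < length w" "l < length w" "p k < p l" for k l
    using that permutes_in_image[OF p] by (metis lessThan_iff permutes_inverses(2)[OF p])
  then show "standardize \<epsilon> w = p"
    unfolding standardize_def
    by (intro order_rank_unique[symmetric] strict_linear_order_precedes p)
qed

lemma super_fundamental_inv_eq_sum_words:
  assumes p: "p permutes {..<n}"
  shows "super_fundamental z \<delta> (perm_descent (inv p)) m n =
     (\<Sum>w | w \<in> words m n \<and> standardize \<delta> w = p. word_weight z w)"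
proof -
  have inv: "permute_list (inv p) (permute_list p w) = w"
    "permute_list p (permute_list (inv p) w) = w" if "length w = n" for w :: "nat list"
    using that p permutes_inv[OF p] permutes_inv_o[OF p] by (simp_all flip: permute_list_compose)
  show ?thesis
    unfolding super_fundamental_def
  proof (rule sum.reindex_bij_witness[where i = "permute_list (inv p)" and j = "permute_list p"])
    fix a assume a: "a \<in> compatible_words \<delta> (perm_descent (inv p)) m n"
    then have length: "length a = n" by (simp add: compatible_words_def words_def)
    then show "permute_list (inv p) (permute_list p a) = a" by (rule inv)
    show "permute_list p a \<in> {w \<in> words m n. standardize \<delta> w = p}"
      using a length p inv(1)[OF length]
      by (simp add: compatible_words_def permute_list_in_words standardize_eq_iff)
    show "word_weight z (permute_list p a) = word_weight z a"
      using length p by (simp add: word_weight_permute_list)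
  next
    fix w assume w: "w \<in> {w \<in> words m n. standardize \<delta> w = p}"
    then have length: "length w = n" by (simp add: words_def)
    then show "permute_list p (permute_list (inv p) w) = w" by (rule inv)
    show "permute_list (inv p) w \<in> compatible_words \<delta> (perm_descent (inv p)) m n"
      using w length p permutes_inv[OF p] standardize_eq_iff[of p w \<delta>]
      by (simp add: compatible_words_def permute_list_in_words)
  qed
qed

lemma sum_permutes_super_fundamental_inv:
  "(\<Sum>p | p permutes {..<n}. f p * super_fundamental z \<delta> (perm_descent (inv p)) m n) =
   (\<Sum>w\<in>words m n. f (standardize \<delta> w) * word_weight z w)"
proof -
  have "(\<Sum>p | p permutes {..<n}. f p * super_fundamental z \<delta> (perm_descent (inv p)) m n)
      = (\<Sum>p | p permutes {..<n}. \<Sum>w | w \<in> words m n \<and> standardize \<delta> w = p.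
          f (standardize \<delta> w) * word_weight z w)"
    by (simp add: super_fundamental_inv_eq_sum_words sum_distrib_left)
  also have "\<dots> = (\<Sum>w\<in>words m n. f (standardize \<delta> w) * word_weight z w)"
    using standardize_permutes[of \<delta>]
    by (intro sum.group) (auto simp: finite_permutations dest: words_length)
  finally show ?thesis .
qed

section \<open>The super Cauchy identity\<close>

lemma sum_words_append:
  assumes "k \<le> n"
  shows "(\<Sum>w\<in>words m n. f w) = (\<Sum>u\<in>words m k. \<Sum>v\<in>words m (n - k). f (u @ v))"
proof -
  have "(\<Sum>w\<in>words m n. f w) = (\<Sum>(u, v)\<in>words m k \<times> words m (n - k). f (u @ v))"
    using assms
    by (intro sum.reindex_bij_witness
        [where i = "\<lambda>(u, v). u @ v" and j = "\<lambda>w. (take k w, drop k w)"])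
      (auto simp: words_def dest: in_set_takeD in_set_dropD)
  then show ?thesis by (simp add: sum.cartesian_product)
qed

lemma word_descent_append_left:
  assumes "Suc k < length u"
  shows "word_descent \<delta> (u @ v) (Suc k) \<longleftrightarrow> word_descent \<delta> u (Suc k)"
  using assms by (simp add: word_descent_def nth_append)

lemma word_descent_append_right:
  "word_descent \<delta> (u @ v) (length u + Suc k) \<longleftrightarrow> word_descent \<delta> v (Suc k)"
  by (simp add: word_descent_def nth_append)

definition monotone_words :: "(nat \<Rightarrow> bool) \<Rightarrow> bool \<Rightarrow> nat \<Rightarrow> nat \<Rightarrow> nat list set" where
  "monotone_words \<delta> b m n = {w \<in> words m n. \<forall>k. Suc k < n \<longrightarrow> word_descent \<delta> w (Suc k) = b}"

lemma monotone_words_subset: "monotone_words \<delta> b m n \<subseteq> words m n"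
  by (auto simp: monotone_words_def)

lemma word_descents_append_right_iff:
  assumes "v \<in> words m (n - length u)"
  shows "(\<forall>l\<in>{length u<..<n}. word_descent \<delta> (u @ v) l = b) \<longleftrightarrow>
    v \<in> monotone_words \<delta> b m (n - length u)"
proof -
  have "(\<forall>l\<in>{length u<..<n}. P l) \<longleftrightarrow> (\<forall>k. Suc k < n - length u \<longrightarrow> P (length u + Suc k))"
    for P :: "nat \<Rightarrow> bool"
  proof (intro iffI ballI)
    fix l assume "\<forall>k. Suc k < n - length u \<longrightarrow> P (length u + Suc k)" "l \<in> {length u<..<n}"
    then show "P l" by (auto dest: spec[of _ "l - Suc (length u)"])
  qed auto
  then show ?thesis
    using assms by (simp add: monotone_words_def word_descent_append_right del: add_Suc_right)
qed

lemma compatible_no_descents_iff: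
  "compatible \<delta> (\<lambda>_. False) w \<longleftrightarrow> (\<forall>k. Suc k < length w \<longrightarrow> \<not> word_descent \<delta> w (Suc k))"
  unfolding compatible_def word_descent_def by (intro all_cong) auto

lemma compatible_all_descents_iff:
  "compatible \<delta> (\<lambda>_. True) (rev w) \<longleftrightarrow> (\<forall>k. Suc k < length w \<longrightarrow> word_descent \<delta> w (Suc k))"
proof -
  let ?n = "length w"
  have "compatible \<delta> (\<lambda>_. True) (rev w) \<longleftrightarrow>
      (\<forall>k. Suc k < ?n \<longrightarrow> word_descent \<delta> w (Suc (?n - Suc (Suc k))))"
    unfolding compatible_def word_descent_def length_rev
    by (intro all_cong) (auto simp: rev_nth Suc_diff_Suc)
  also have "\<dots> \<longleftrightarrow> (\<forall>k. Suc k < ?n \<longrightarrow> word_descent \<delta> w (Suc k))"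
  proof (intro iffI allI impI)
    fix k assume "\<forall>k. Suc k < ?n \<longrightarrow> word_descent \<delta> w (Suc (?n - Suc (Suc k)))" "Suc k < ?n"
    moreover have "?n - Suc (Suc (?n - Suc (Suc k))) = k" using \<open>Suc k < ?n\<close> by simp
    ultimately show "word_descent \<delta> w (Suc k)" by (auto dest: spec[of _ "?n - Suc (Suc k)"])
  qed auto
  finally show ?thesis .
qed

lemma sum_monotone_words:
  "(\<Sum>w\<in>monotone_words \<delta> b m n. word_weight z w) = super_fundamental z \<delta> (\<lambda>_. b) m n"
proof (cases b)
  case False
  then have "monotone_words \<delta> b m n = compatible_words \<delta> (\<lambda>_. b) m n"
    unfolding monotone_words_def compatible_words_def
    by (auto simp: compatible_no_descents_iff words_length)
  then show ?thesis by (simp add: super_fundamental_def)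
next
  case True
  then have rev: "rev w \<in> compatible_words \<delta> (\<lambda>_. b) m n \<longleftrightarrow> w \<in> monotone_words \<delta> b m n" for w
    by (auto simp: monotone_words_def compatible_words_def compatible_all_descents_iff words_def)
  show ?thesis
    unfolding super_fundamental_def
    by (intro sum.reindex_bij_witness[where i = rev and j = rev]) (simp_all flip: rev)
qed

lemma sum_words_monotone_suffix:
  assumes k: "k \<le> n" and f_append: "\<And>u v. length u = k \<Longrightarrow> f (u @ v) = f u"
  shows "(\<Sum>w | w \<in> words m n \<and> (\<forall>l\<in>{k<..<n}. word_descent \<delta> w l = b). f w * word_weight z w) =
    (\<Sum>u\<in>words m k. f u * word_weight z u) * super_fundamental z \<delta> (\<lambda>_. b) m (n - k)"
proof -
  let ?suffix = "\<lambda>w. \<forall>l\<in>{k<..<n}. word_descent \<delta> w l = b"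
  let ?V = "monotone_words \<delta> b m (n - k)"
  have "(\<Sum>w | w \<in> words m n \<and> ?suffix w. f w * word_weight z w) =
      (\<Sum>w\<in>words m n. if ?suffix w then f w * word_weight z w else 0)"
    by (rule sum.inter_filter) simp
  also have "\<dots> = (\<Sum>u\<in>words m k. \<Sum>v\<in>words m (n - k).
      if v \<in> ?V then (f u * word_weight z u) * word_weight z v else 0)"
    unfolding sum_words_append[OF k]
  proof (intro sum.cong refl)
    fix u v assume u: "u \<in> words m k" and v: "v \<in> words m (n - k)"
    then have "?suffix (u @ v) \<longleftrightarrow> v \<in> ?V"
      using word_descents_append_right_iff[of v m n u] by (simp add: words_length)
    then show "(if ?suffix (u @ v) then f (u @ v) * word_weight z (u @ v) else 0) =
        (if v \<in> ?V then (f u * word_weight z u) * word_weight z v else 0)"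
      using u by (simp add: words_length f_append mult.assoc)
  qed
  also have "\<dots> = (\<Sum>u\<in>words m k. \<Sum>v\<in>?V. (f u * word_weight z u) * word_weight z v)"
    by (simp add: Int_absorb1 monotone_words_subset flip: sum.inter_restrict)
  finally show ?thesis
    by (simp only: sum_monotone_words flip: sum_distrib_left sum_distrib_right)
qed

definition super_Cauchy_sum ::
  "(nat \<Rightarrow> 'a::comm_semiring_1) \<Rightarrow> (nat \<Rightarrow> bool) \<Rightarrow> nat \<Rightarrow> (nat \<Rightarrow> 'a) \<Rightarrow> (nat \<Rightarrow> bool) \<Rightarrow>
    nat \<Rightarrow> nat \<Rightarrow> 'a" where
  "super_Cauchy_sum x \<epsilon> q z \<delta> m n = (\<Sum>p | p permutes {..<n}.
     super_fundamental x \<epsilon> (perm_descent p) q n * super_fundamental z \<delta> (perm_descent (inv p)) m n)"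

lemma super_Cauchy_sum_eq_sum_words:
  "super_Cauchy_sum x \<epsilon> q z \<delta> m n =
     (\<Sum>w\<in>words m n. super_fundamental x \<epsilon> (word_descent \<delta> w) q n * word_weight z w)"
  unfolding super_Cauchy_sum_def sum_permutes_super_fundamental_inv
proof (intro sum.cong refl arg_cong2[where f = "(*)"] super_fundamental_cong)
  fix w k assume "w \<in> words m n" "Suc k < n"
  then show "perm_descent (standardize \<delta> w) (Suc k) = word_descent \<delta> w (Suc k)"
    by (intro perm_descent_standardize) (simp add: words_length)
qed

lemma super_Cauchy_sum_Suc:
  "super_Cauchy_sum x \<epsilon> (Suc q) z \<delta> m n = (\<Sum>k\<le>n. super_Cauchy_sum x \<epsilon> q z \<delta> m k
     * (x q ^ (n - k) * super_fundamental z \<delta> (\<lambda>_. \<epsilon> q) m (n - k)))"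
proof -
  let ?F = "\<lambda>k w. super_fundamental x \<epsilon> (word_descent \<delta> w) q k"
  let ?suffix = "\<lambda>k w. \<forall>l\<in>{k<..<n}. word_descent \<delta> w l = \<epsilon> q"
  have "super_Cauchy_sum x \<epsilon> (Suc q) z \<delta> m n = (\<Sum>w\<in>words m n. \<Sum>k\<le>n.
      if ?suffix k w then x q ^ (n - k) * (?F k w * word_weight z w) else 0)"
    unfolding super_Cauchy_sum_eq_sum_words super_fundamental_top_block sum_distrib_right
    by (intro sum.cong refl) (simp add: mult.assoc)
  also have "\<dots> = (\<Sum>k\<le>n. \<Sum>w\<in>words m n.
      if ?suffix k w then x q ^ (n - k) * (?F k w * word_weight z w) else 0)"
    by (rule sum.swap)
  also have "\<dots> = (\<Sum>k\<le>n. x q ^ (n - k) *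
      (\<Sum>w | w \<in> words m n \<and> ?suffix k w. ?F k w * word_weight z w))"
    unfolding sum_distrib_left by (intro sum.cong refl sum.inter_filter[symmetric]) simp
  also have "\<dots> = (\<Sum>k\<le>n. super_Cauchy_sum x \<epsilon> q z \<delta> m k
     * (x q ^ (n - k) * super_fundamental z \<delta> (\<lambda>_. \<epsilon> q) m (n - k)))"
  proof (intro sum.cong refl)
    fix k assume "k \<in> {..n}"
    moreover have "?F k (u @ v) = ?F k u" if "length u = k" for u v
      using that by (intro super_fundamental_cong word_descent_append_left) simp
    ultimately have "(\<Sum>w | w \<in> words m n \<and> ?suffix k w. ?F k w * word_weight z w)
        = super_Cauchy_sum x \<epsilon> q z \<delta> m k * super_fundamental z \<delta> (\<lambda>_. \<epsilon> q) m (n - k)"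
      unfolding super_Cauchy_sum_eq_sum_words by (intro sum_words_monotone_suffix) simp_all
    then show "x q ^ (n - k) * (\<Sum>w | w \<in> words m n \<and> ?suffix k w. ?F k w * word_weight z w)
      = super_Cauchy_sum x \<epsilon> q z \<delta> m k
        * (x q ^ (n - k) * super_fundamental z \<delta> (\<lambda>_. \<epsilon> q) m (n - k))"
      by (simp only: mult_ac)
  qed
  finally show ?thesis .
qed

definition monotone_fps ::
  "'a::comm_semiring_1 \<Rightarrow> (nat \<Rightarrow> 'a) \<Rightarrow> (nat \<Rightarrow> bool) \<Rightarrow> bool \<Rightarrow> nat \<Rightarrow> 'a fps" where
  "monotone_fps c z \<delta> b m = Abs_fps (\<lambda>n. c ^ n * super_fundamental z \<delta> (\<lambda>_. b) m n)"

lemma monotone_fps_0: "monotone_fps c z \<delta> b 0 = 1"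
proof (rule fps_ext)
  show "monotone_fps c z \<delta> b 0 $ n = 1 $ n" for n by (cases n) (simp_all add: monotone_fps_def)
qed

lemma monotone_fps_Suc:
  "(if b = \<delta> m then 1 - fps_const (c * z m) * fps_X else 1) * monotone_fps c z \<delta> b (Suc m)
     = (if b = \<delta> m then 1 else 1 + fps_const (c * z m) * fps_X) * monotone_fps c z \<delta> b m"
    (is "?d * ?M' = ?n * ?M") for c :: "'a::comm_ring_1"
proof (rule fps_ext)
  show "(?d * ?M') $ n = (?n * ?M) $ n" for n
    by (cases n) (auto simp: monotone_fps_def super_fundamental_Suc left_diff_distrib distrib_right
        mult.assoc mult.left_commute distrib_left)
qed

lemma monotone_fps_product:
  "(\<Prod>j<m. if b = \<delta> j then 1 - fps_const (c * z j) * fps_X else 1) * monotone_fps c z \<delta> b m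
     = (\<Prod>j<m. if b = \<delta> j then 1 else 1 + fps_const (c * z j) * fps_X)"
  for c :: "'a::comm_ring_1"
proof (induction m)
  case (Suc m)
  show ?case
    unfolding prod.lessThan_Suc mult.assoc monotone_fps_Suc
    by (simp only: mult.left_commute Suc) (simp only: mult_ac)
qed (simp add: monotone_fps_0)

theorem super_Cauchy_identity:
  "(\<Prod>i<q. \<Prod>j<m. if \<epsilon> i = \<delta> j then 1 - fps_const (x i * z j) * fps_X else 1)
     * Abs_fps (super_Cauchy_sum x \<epsilon> q z \<delta> m)
   = (\<Prod>i<q. \<Prod>j<m. if \<epsilon> i = \<delta> j then 1 else 1 + fps_const (x i * z j) * fps_X)"
  for x z :: "nat \<Rightarrow> 'a::comm_ring_1"
proof (induction q)
  case 0
  have "Abs_fps (super_Cauchy_sum x \<epsilon> 0 z \<delta> m) $ n = 1 $ n" for n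
    by (cases n) (simp_all add: super_Cauchy_sum_def)
  then show ?case by (simp add: fps_eq_iff)
next
  case (Suc q)
  have "Abs_fps (super_Cauchy_sum x \<epsilon> (Suc q) z \<delta> m)
      = Abs_fps (super_Cauchy_sum x \<epsilon> q z \<delta> m) * monotone_fps (x q) z \<delta> (\<epsilon> q) m"
    by (rule fps_ext) (simp add: monotone_fps_def fps_mult_nth super_Cauchy_sum_Suc atLeast0AtMost)
  then show ?case
    unfolding prod.lessThan_Suc Suc[symmetric] monotone_fps_product[where b = "\<epsilon> q", symmetric]
    by (simp only: mult_ac)
qed

section \<open>The alternating alphabet\<close>

text \<open>The alphabet \<open>0, 1', 1, \<dots>, i', i\<close> is \<open>{..<2 * i + 1}\<close>, and its odd letters are barred.\<close>

definition alternating_weight :: "'a::one \<Rightarrow> nat \<Rightarrow> 'a" where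
  "alternating_weight y c = (if odd c then y else 1)"

lemma prod_alternating:
  "(\<Prod>c<Suc (2 * i). if odd c then a else b) = a ^ i * b ^ Suc i"
  for a b :: "'a::comm_monoid_mult"
  by (induction i) (simp_all add: mult_ac)

lemma prod_alternating_pairs:
  "(\<Prod>k<Suc (2 * i). \<Prod>l<Suc (2 * j).
      if odd k then if odd l then a else b else if odd l then c else d) =
    a ^ (i * j) * b ^ (i * Suc j) * c ^ (Suc i * j) * d ^ (Suc i * Suc j)"
  for a b c d :: "'a::comm_monoid_mult"
proof -
  have inner_prod:
    "(\<Prod>l<Suc (2 * j). if odd k then if odd l then a else b else if odd l then c else d) =
      (if odd k then a ^ j * b ^ Suc j else c ^ j * d ^ Suc j)" for k
    by (cases "odd k") (simp_all only: prod_alternating if_True if_False simp_thms)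
  show ?thesis
    unfolding inner_prod prod_alternating power_mult_distrib power_mult[symmetric]
    by (simp only: mult_ac)
qed

lemma alternating_Cauchy_identity:
  "(1 - fps_const (y * z) * fps_X) ^ (i * j) * (1 - fps_X) ^ (Suc i * Suc j)
     * Abs_fps (super_Cauchy_sum (alternating_weight y) odd (Suc (2 * i))
         (alternating_weight z) odd (Suc (2 * j)))
   = (1 + fps_const y * fps_X) ^ (i * Suc j) * (1 + fps_const z * fps_X) ^ (Suc i * j)"
  for y z :: "'a::comm_ring_1"
proof -
  let ?X = "\<lambda>k l. fps_const (alternating_weight y k * alternating_weight z l) * fps_X"
  have "(\<Prod>k<Suc (2 * i). \<Prod>l<Suc (2 * j). if odd k = odd l then 1 - ?X k l else 1) =
      (\<Prod>k<Suc (2 * i). \<Prod>l<Suc (2 * j).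
        if odd k then if odd l then 1 - fps_const (y * z) * fps_X else 1
        else if odd l then 1 else 1 - fps_X)"
    by (intro prod.cong refl) (simp add: alternating_weight_def)
  moreover have "(\<Prod>k<Suc (2 * i). \<Prod>l<Suc (2 * j). if odd k = odd l then 1 else 1 + ?X k l) =
      (\<Prod>k<Suc (2 * i). \<Prod>l<Suc (2 * j).
        if odd k then if odd l then 1 else 1 + fps_const y * fps_X
        else if odd l then 1 + fps_const z * fps_X else 1)"
    by (intro prod.cong refl) (simp add: alternating_weight_def)
  ultimately show ?thesis
    using super_Cauchy_identity[where \<epsilon> = odd and q = "Suc (2 * i)" and x = "alternating_weight y"
        and \<delta> = odd and m = "Suc (2 * j)" and z = "alternating_weight z"]
    by (simp only: prod_alternating_pairs power_one mult_1_left mult_1_right)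
qed

section \<open>Descents and left peaks\<close>

definition descent_count :: "(nat \<Rightarrow> bool) \<Rightarrow> nat \<Rightarrow> nat" where
  "descent_count D n = card {k. k < n \<and> D k}"

definition left_peak_count :: "(nat \<Rightarrow> bool) \<Rightarrow> nat \<Rightarrow> nat" where
  "left_peak_count D n = card {k. k < n \<and> D k \<and> \<not> D (k - 1)}"

lemma card_less_Suc_filter:
  "card {k. k < Suc n \<and> P k} = card {k. k < n \<and> P k} + (if P n then 1 else 0)"
proof -
  have "{k. k < Suc n \<and> P k} = (if P n then insert n {k. k < n \<and> P k} else {k. k < n \<and> P k})"
    by (auto simp: less_Suc_eq)
  then show ?thesis by simp
qed

lemma descent_count_Suc: "descent_count D (Suc n) = descent_count D n + (if D n then 1 else 0)"
  unfolding descent_count_def by (rule card_less_Suc_filter)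

lemma left_peak_count_Suc:
  "left_peak_count D (Suc n) = left_peak_count D n + (if D n \<and> \<not> D (n - 1) then 1 else 0)"
  unfolding left_peak_count_def by (rule card_less_Suc_filter)

lemma inv_map_permutation:
  assumes f: "inj_on f A" and p: "p permutes A"
  shows "inv (map_permutation A f p) = map_permutation A f (inv p)"
proof (rule inv_unique_comp)
  show "map_permutation A f p \<circ> map_permutation A f (inv p) = id"
    using map_permutation_compose'[OF f permutes_inv[OF p], of p]
    by (simp add: permutes_inv_o[OF p] map_permutation_id'[OF f])
  show "map_permutation A f (inv p) \<circ> map_permutation A f p = id"
    using map_permutation_compose'[OF f p, of "inv p"]
    by (simp add: permutes_inv_o[OF p] map_permutation_id'[OF f])
qed

lemma bij_betw_map_permutation:
  assumes f: "bij_betw f A B"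
  shows "bij_betw (map_permutation A f) {p. p permutes A} {p. p permutes B}"
proof (rule bij_betw_byWitness[where f' = "map_permutation B (inv_into A f)"])
  have inv: "bij_betw (inv_into A f) B A" by (rule bij_betw_inv_into[OF f])
  show "\<forall>p\<in>{p. p permutes A}. map_permutation B (inv_into A f) (map_permutation A f p) = p"
    using map_permutation_compose_inv[OF f] bij_betw_inv_into_left[OF f] by simp
  show "\<forall>p\<in>{p. p permutes B}. map_permutation A f (map_permutation B (inv_into A f) p) = p"
    using map_permutation_compose_inv[OF inv] bij_betw_inv_into_right[OF f] by simp
  show "map_permutation A f ` {p. p permutes A} \<subseteq> {p. p permutes B}"
    using f by (auto intro: map_permutation_permutes)
  show "map_permutation B (inv_into A f) ` {p. p permutes B} \<subseteq> {p. p permutes A}"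
    using inv by (auto intro: map_permutation_permutes)
qed

lemma map_permutation_Suc_apply:
  assumes "k < n"
  shows "map_permutation {..<n} Suc p (Suc k) = Suc (p k)"
  using assms by (simp add: map_permutation_apply)

lemma des_map_permutation_Suc:
  "des n (map_permutation {..<n} Suc p) = descent_count (perm_descent p) n"
proof -
  have "is_descent n (map_permutation {..<n} Suc p) k \<longleftrightarrow> k < n \<and> perm_descent p k" for k
    by (cases k) (auto simp: is_descent_def perm_descent_def map_permutation_Suc_apply)
  then show ?thesis by (simp add: des_def descent_count_def)
qed

lemma lpk_map_permutation_Suc:
  assumes p: "p permutes {..<n}"
  shows "lpk n (map_permutation {..<n} Suc p) = left_peak_count (perm_descent p) n"
proof -
  have "is_left_peak n (map_permutation {..<n} Suc p) k \<longleftrightarrow>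
      k < n \<and> perm_descent p k \<and> \<not> perm_descent p (k - 1)" for k
  proof (cases k)
    case 0
    then show ?thesis by (simp add: is_left_peak_def perm_descent_def)
  next
    case (Suc l)
    have "p (l - 1) \<noteq> p l" if "l \<noteq> 0" using that permutes_inj[OF p] by (simp add: inj_eq)
    then show ?thesis
      by (cases l) (auto simp: Suc is_left_peak_def is_peak_def perm_descent_def
          map_permutation_Suc_apply numeral_2_eq_2)
  qed
  then show ?thesis by (simp add: lpk_def left_peak_count_def)
qed

lemma lpk_des_poly_eq_sum:
  "lpk_des_poly n y z s t = (\<Sum>p | p permutes {..<n}.
     y ^ left_peak_count (perm_descent p) n * z ^ left_peak_count (perm_descent (inv p)) n *
     s ^ descent_count (perm_descent p) n * t ^ descent_count (perm_descent (inv p)) n)"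
proof -
  have bij: "bij_betw Suc {..<n} {1..n}"
    by (simp add: bij_betw_def image_Suc_lessThan)
  have "lpk_des_poly n y z s t = (\<Sum>p | p permutes {..<n}.
      let \<pi> = map_permutation {..<n} Suc p in
      y ^ lpk n \<pi> * z ^ ilpk n \<pi> * s ^ des n \<pi> * t ^ ides n \<pi>)"
    unfolding lpk_des_poly_def Let_def
    by (rule sum.reindex_bij_betw[OF bij_betw_map_permutation[OF bij], symmetric])
  then show ?thesis
    by (simp add: Let_def ilpk_def ides_def inv_map_permutation permutes_inv
        des_map_permutation_Suc lpk_map_permutation_Suc)
qed

section \<open>Counting compatible words by descents and left peaks\<close>

text \<open>The first step counts as an ascent, which is why left peaks appear rather than peaks.\<close>

locale two_state_recurrence =
  fixes y s :: "'a::idom" and D :: "nat \<Rightarrow> bool" and E F :: "nat \<Rightarrow> 'a"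
  assumes not_D_0: "\<not> D 0"
    and E_0: "(1 - s) * E 0 = 1"
    and E_Suc: "E (Suc n) = F (Suc n) + (if D n then F n else E n)"
    and F_Suc: "F (Suc n) = s * E (Suc n) + y * (if D n then F n else s * E n)"
begin

lemma one_minus_s_nonzero: "1 - s \<noteq> 0"
  using E_0 by auto

lemma descent_step:
  assumes "D n"
  shows "(1 - s) * E (Suc n) = (1 + y) * F n" "(1 - s) * F (Suc n) = (y + s) * F n"
  using E_Suc[of n, unfolded if_P[OF assms]] F_Suc[of n, unfolded if_P[OF assms]]
  by algebra+

lemma ascent_step:
  assumes "\<not> D n"
  shows "(1 - s) * E (Suc n) = (1 + y * s) * E n" "(1 - s) * F (Suc n) = s * (1 + y) * E n"
  using E_Suc[of n, unfolded if_not_P[OF assms]] F_Suc[of n, unfolded if_not_P[OF assms]]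
  by algebra+

lemma F_after_descent:
  assumes "D n"
  shows "(1 + y) * F (Suc n) = (y + s) * E (Suc n)"
proof -
  have "(1 - s) * ((1 + y) * F (Suc n)) = (1 - s) * ((y + s) * E (Suc n))"
    using descent_step[OF assms] by algebra
  then show ?thesis using one_minus_s_nonzero by simp
qed

lemma F_after_ascent:
  assumes "\<not> D n"
  shows "(1 + y * s) * F (Suc n) = s * (1 + y) * E (Suc n)"
proof -
  have "(1 - s) * ((1 + y * s) * F (Suc n)) = (1 - s) * (s * (1 + y) * E (Suc n))"
    using ascent_step[OF assms] by algebra
  then show ?thesis using one_minus_s_nonzero by simp
qed

context
  fixes Y S
  assumes S: "S * (1 + y * s) = y + s"
    and Y: "Y * ((y + s) * (1 + y * s)) = (1 + y)\<^sup>2 * s"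
    and nonzero: "1 + y * s \<noteq> 0"
begin

lemma double_descent_step:
  assumes "D n" "D (Suc n)"
  shows "(1 - s) * E (Suc (Suc n)) = (1 + y * s) * S * E (Suc n)"
  using descent_step(1)[OF assms(2)] F_after_descent[OF assms(1)] S by (simp add: mult.commute)

lemma left_peak_step:
  assumes "\<not> D n" "D (Suc n)"
  shows "(1 - s) * E (Suc (Suc n)) = (1 + y * s) * (Y * S) * E (Suc n)"
proof -
  have "(1 + y * s) * ((1 - s) * E (Suc (Suc n))) = (1 + y)\<^sup>2 * s * E (Suc n)"
    using descent_step(1)[OF assms(2)] F_after_ascent[OF assms(1)] by algebra
  also have "\<dots> = (1 + y * s) * ((1 + y * s) * (Y * S) * E (Suc n))"
    using S Y by algebra
  finally show ?thesis using nonzero by simp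
qed

lemma E_step:
  "(1 - s) * E (Suc n) =
     (1 + y * s) * (if D n \<and> \<not> D (n - 1) then Y else 1) * (if D n then S else 1) * E n"
proof (cases "D n")
  case True
  then obtain k where "n = Suc k" using not_D_0 by (cases n) auto
  then show ?thesis
    using True double_descent_step[of k] left_peak_step[of k] by (simp add: mult.assoc)
qed (simp add: ascent_step)

lemma E_closed_form:
  "(1 - s) ^ (n + 1) * E n = (1 + y * s) ^ n * Y ^ left_peak_count D n * S ^ descent_count D n"
proof (induction n)
  case 0
  then show ?case using E_0 by (simp add: left_peak_count_def descent_count_def)
next
  case (Suc n)
  have "(1 - s) ^ (Suc n + 1) * E (Suc n) = (1 - s) ^ (n + 1) * ((1 - s) * E (Suc n))"
    by simp
  also have "\<dots> = (1 + y * s) * (if D n \<and> \<not> D (n - 1) then Y else 1) * (if D n then S else 1)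
      * ((1 - s) ^ (n + 1) * E n)"
    unfolding E_step by (simp only: mult_ac)
  also have "\<dots> = (1 + y * s) ^ Suc n * Y ^ left_peak_count D (Suc n) * S ^ descent_count D (Suc n)"
    unfolding Suc left_peak_count_Suc descent_count_Suc by simp
  finally show ?case .
qed

end

end

definition unbarred_top_fps :: "'a::comm_semiring_1 \<Rightarrow> (nat \<Rightarrow> bool) \<Rightarrow> nat \<Rightarrow> 'a fps" where
  "unbarred_top_fps y D n =
     Abs_fps (\<lambda>i. super_fundamental (alternating_weight y) odd D (Suc (2 * i)) n)"

definition barred_top_fps :: "'a::comm_semiring_1 \<Rightarrow> (nat \<Rightarrow> bool) \<Rightarrow> nat \<Rightarrow> 'a fps" where
  "barred_top_fps y D n = Abs_fps (\<lambda>i. super_fundamental (alternating_weight y) odd D (2 * i) n)"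

lemma unbarred_top_fps_0: "(1 - fps_X) * unbarred_top_fps y D 0 = 1" for y :: "'a::comm_ring_1"
proof (rule fps_ext)
  show "((1 - fps_X) * unbarred_top_fps y D 0) $ i = 1 $ i" for i
    by (cases i) (simp_all add: unbarred_top_fps_def left_diff_distrib)
qed

lemma unbarred_top_fps_Suc:
  "unbarred_top_fps y D (Suc n) = barred_top_fps y D (Suc n)
     + (if D n then barred_top_fps y D n else unbarred_top_fps y D n)"
  by (rule fps_ext)
    (simp add: unbarred_top_fps_def barred_top_fps_def super_fundamental_Suc alternating_weight_def)

lemma barred_top_fps_Suc:
  assumes "\<not> D 0"
  shows "barred_top_fps y D (Suc n) = fps_X * unbarred_top_fps y D (Suc n)
     + fps_const y * (if D n then barred_top_fps y D n else fps_X * unbarred_top_fps y D n)"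
proof (rule fps_ext)
  fix i
  show "barred_top_fps y D (Suc n) $ i = (fps_X * unbarred_top_fps y D (Suc n)
     + fps_const y * (if D n then barred_top_fps y D n else fps_X * unbarred_top_fps y D n)) $ i"
  proof (cases i)
    case 0
    have "n \<noteq> 0" if "D n" using that assms by (cases n) auto
    then show ?thesis
      using 0 by (cases n) (auto simp: unbarred_top_fps_def barred_top_fps_def)
  next
    case (Suc j)
    then show ?thesis
      by (simp add: unbarred_top_fps_def barred_top_fps_def alternating_weight_def
          super_fundamental_Suc[of _ _ _ "Suc (2 * j)"])
  qed
qed

section \<open>Comparison of coefficients\<close>

lemma fps3_divide_eqI:
  fixes f g h :: "'a::field fps fps fps"
  assumes "g $ 0 $ 0 $ 0 \<noteq> 0" "h * g = f"
  shows "f / g = h"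
  unfolding fps3_divide_unit[OF assms(1)] assms(2)[symmetric]
  by (simp add: mult.assoc fps3_mult_inverse[OF assms(1)])

lemma fps3_divide_mult_cancel:
  fixes f g :: "'a::field fps fps fps"
  assumes "g $ 0 $ 0 $ 0 \<noteq> 0"
  shows "f / g * g = f"
  unfolding fps3_divide_unit[OF assms]
  by (simp add: mult.assoc mult.commute[of _ g] fps3_mult_inverse[OF assms])

lemma fps3_mult_nth_0: "(f * g) $ 0 $ 0 $ 0 = f $ 0 $ 0 $ 0 * g $ 0 $ 0 $ 0"
  for f g :: "'a::field fps fps fps"
  by (simp add: fps_mult_nth)

lemma fps3_power_nth_0: "(f ^ n) $ 0 $ 0 $ 0 = (f $ 0 $ 0 $ 0) ^ n"
  for f :: "'a::field fps fps fps"
  by (induction n) (simp_all add: fps3_mult_nth_0)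

lemma fps3_summable_single:
  assumes "\<And>k a b c. f k $ a $ b $ c = (if k = g a b c then v a b c else 0)"
  shows "fps3_summable f A"
    and "fps3_sum f A $ a $ b $ c = (if g a b c \<in> A then v a b c else 0)"
proof -
  have sub: "{k \<in> A. f k $ a $ b $ c \<noteq> 0} \<subseteq> {g a b c}" for a b c by (auto simp: assms)
  show "fps3_summable f A"
    unfolding fps3_summable_def by (intro allI finite_subset[OF sub]) simp
  have "{k \<in> A. f k $ a $ b $ c \<noteq> 0} = (if g a b c \<in> A \<and> v a b c \<noteq> 0 then {g a b c} else {})"
    by (auto simp: assms)
  then show "fps3_sum f A $ a $ b $ c = (if g a b c \<in> A then v a b c else 0)"
    by (simp add: fps3_sum_def assms)
qed

definition lpk_arg :: "'a \<Rightarrow> 'a \<Rightarrow> 'a::{comm_semiring_1,inverse}" where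
  "lpk_arg v s = (1 + v)\<^sup>2 * s / ((v + s) * (1 + v * s))"

definition des_arg :: "'a \<Rightarrow> 'a \<Rightarrow> 'a::{comm_semiring_1,inverse}" where
  "des_arg v s = (v + s) / (1 + v * s)"

lemma hom_unbarred_top_fps:
  fixes h :: "'b::comm_ring_1 fps \<Rightarrow> 'a::field fps fps fps" and y :: 'b
  assumes D: "\<not> D 0"
    and h_add: "\<And>f g. h (f + g) = h f + h g" and h_mult: "\<And>f g. h (f * g) = h f * h g"
    and h_1: "h 1 = 1"
  defines "v \<equiv> h (fps_const y)" and "s \<equiv> h fps_X"
  assumes unit: "(1 + v * s) $ 0 $ 0 $ 0 \<noteq> 0" "(v + s) $ 0 $ 0 $ 0 \<noteq> 0"
  shows "(1 - s) ^ (n + 1) * h (unbarred_top_fps y D n)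
    = (1 + v * s) ^ n * lpk_arg v s ^ left_peak_count D n * des_arg v s ^ descent_count D n"
proof -
  interpret two_state_recurrence v s D
    "\<lambda>n. h (unbarred_top_fps y D n)" "\<lambda>n. h (barred_top_fps y D n)"
  proof
    have "h (1 - fps_X) + h fps_X = 1" by (simp add: h_1 flip: h_add)
    then have "1 - s = h (1 - fps_X)" by (simp add: s_def algebra_simps)
    then show "(1 - s) * h (unbarred_top_fps y D 0) = 1"
      by (simp add: h_1 unbarred_top_fps_0 flip: h_mult)
  next
    fix n
    show "h (unbarred_top_fps y D (Suc n)) = h (barred_top_fps y D (Suc n))
        + (if D n then h (barred_top_fps y D n) else h (unbarred_top_fps y D n))"
      unfolding unbarred_top_fps_Suc[of y D n] h_add by simp
    show "h (barred_top_fps y D (Suc n)) = s * h (unbarred_top_fps y D (Suc n))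
        + v * (if D n then h (barred_top_fps y D n) else s * h (unbarred_top_fps y D n))"
      unfolding barred_top_fps_Suc[of D y n, OF D] h_add h_mult by (simp add: s_def v_def h_mult)
  qed (rule D)
  show ?thesis
  proof (rule E_closed_form)
    show "des_arg v s * (1 + v * s) = v + s"
      unfolding des_arg_def by (rule fps3_divide_mult_cancel[OF unit(1)])
    show "lpk_arg v s * ((v + s) * (1 + v * s)) = (1 + v)\<^sup>2 * s"
      unfolding lpk_arg_def using unit
      by (intro fps3_divide_mult_cancel) (simp only: fps3_mult_nth_0 mult_eq_0_iff simp_thms)
    show "1 + v * s \<noteq> 0" using unit(1) by (metis fps_zero_nth)
  qed
qed

lemma fps_const_sum: "fps_const (\<Sum>i\<in>A. f i) = (\<Sum>i\<in>A. fps_const (f i))"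
  by (induction A rule: infinite_finite_induct) (simp_all flip: fps_const_add)

lemma word_weight_fps_const: "word_weight (\<lambda>c. fps_const (x c)) w = fps_const (word_weight x w)"
  by (induction w) simp_all

lemma super_fundamental_fps_const:
  "super_fundamental (\<lambda>c. fps_const (x c)) \<epsilon> D m n = fps_const (super_fundamental x \<epsilon> D m n)"
  by (simp add: super_fundamental_def word_weight_fps_const fps_const_sum)

lemma super_Cauchy_sum_fps_const:
  "super_Cauchy_sum (\<lambda>c. fps_const (x c)) \<epsilon> q (\<lambda>c. fps_const (z c)) \<delta> m
     = (\<lambda>n. fps_const (super_Cauchy_sum x \<epsilon> q z \<delta> m n))"
  by (simp add: fun_eq_iff super_Cauchy_sum_def super_fundamental_fps_const fps_const_sum)

lemma alternating_weight_fps_const: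
  "alternating_weight (fps_const y) = (\<lambda>c. fps_const (alternating_weight y c))"
  by (auto simp: alternating_weight_def)

locale series_variables =
  fixes y z :: "'a::field" and Y Z S T X :: "'a fps fps fps"
  assumes y_nonzero: "y \<noteq> 0" and z_nonzero: "z \<noteq> 0"
    and Y_eq: "Y = fps_const (fps_const (fps_const y))"
    and Z_eq: "Z = fps_const (fps_const (fps_const z))"
    and S_eq: "S = fps_const (fps_const fps_X)"
    and T_eq: "T = fps_const fps_X"
    and X_eq: "X = fps_X"
begin

lemma denominators_nth_0:
  "(1 - S) $ 0 $ 0 $ 0 \<noteq> 0" "(1 - T) $ 0 $ 0 $ 0 \<noteq> 0"
  "(1 + Y * S) $ 0 $ 0 $ 0 \<noteq> 0" "(1 + Z * T) $ 0 $ 0 $ 0 \<noteq> 0"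
  "(Y + S) $ 0 $ 0 $ 0 \<noteq> 0" "(Z + T) $ 0 $ 0 $ 0 \<noteq> 0"
  "(1 - Y * Z * X) $ 0 $ 0 $ 0 \<noteq> 0" "(1 - X) $ 0 $ 0 $ 0 \<noteq> 0"
  using y_nonzero z_nonzero by (simp_all add: Y_eq Z_eq S_eq T_eq X_eq)

lemmas denominator_simps =
  fps3_mult_nth_0 fps3_power_nth_0 mult_eq_0_iff power_eq_0_iff denominators_nth_0 simp_thms

definition lhs_term :: "nat \<Rightarrow> 'a fps fps fps" where
  "lhs_term n = (1 + Y * S) ^ n * (1 + Z * T) ^ n
     * lpk_des_poly n (lpk_arg Y S) (lpk_arg Z T) (des_arg Y S) (des_arg Z T)
     / ((1 - S) ^ (n + 1) * (1 - T) ^ (n + 1)) * X ^ n"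

definition rhs_term :: "nat \<times> nat \<Rightarrow> 'a fps fps fps" where
  "rhs_term = (\<lambda>(i, j). (1 + Y * X) ^ (i * (j + 1)) * (1 + Z * X) ^ ((i + 1) * j)
     / ((1 - Y * Z * X) ^ (i * j) * (1 - X) ^ ((i + 1) * (j + 1))) * S ^ i * T ^ j)"

definition coefficient :: "nat \<Rightarrow> nat \<Rightarrow> nat \<Rightarrow> 'a" where
  "coefficient a b c = super_Cauchy_sum (alternating_weight y) odd (Suc (2 * c))
     (alternating_weight z) odd (Suc (2 * b)) a"

lemma unbarred_top_fps_S:
  "(1 - S) ^ (n + 1) * fps_const (fps_const (unbarred_top_fps y (perm_descent p) n)) =
     (1 + Y * S) ^ n * lpk_arg Y S ^ left_peak_count (perm_descent p) n
       * des_arg Y S ^ descent_count (perm_descent p) n"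
  using hom_unbarred_top_fps[where h = "\<lambda>f. fps_const (fps_const f)" and y = y]
    denominators_nth_0(3,5)
  by (simp add: perm_descent_def flip: Y_eq S_eq)

lemma unbarred_top_fps_T:
  "(1 - T) ^ (n + 1) * fps_const (unbarred_top_fps (fps_const z) (perm_descent p) n) =
     (1 + Z * T) ^ n * lpk_arg Z T ^ left_peak_count (perm_descent p) n
       * des_arg Z T ^ descent_count (perm_descent p) n"
  using hom_unbarred_top_fps[where h = fps_const and y = "fps_const z"] denominators_nth_0(4,6)
  by (simp add: perm_descent_def flip: Z_eq T_eq)

lemma lhs_term_nth: "lhs_term n $ a $ b $ c = (if n = a then coefficient a b c else 0)"
proof -
  define Us where "Us = (\<lambda>p. unbarred_top_fps y (perm_descent p) n)"
  define Ut where "Ut = (\<lambda>p. unbarred_top_fps (fps_const z) (perm_descent (inv p)) n)"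
  define H where "H = (\<Sum>p | p permutes {..<n}. fps_const (Us p) * Ut p)"
  have "fps_const H * ((1 - S) ^ (n + 1) * (1 - T) ^ (n + 1)) = (\<Sum>p | p permutes {..<n}.
      ((1 - S) ^ (n + 1) * fps_const (fps_const (Us p))) * ((1 - T) ^ (n + 1) * fps_const (Ut p)))"
    unfolding H_def fps_const_sum sum_distrib_right fps_const_mult[symmetric]
    by (simp only: mult_ac)
  also have "\<dots> = (1 + Y * S) ^ n * (1 + Z * T) ^ n
      * lpk_des_poly n (lpk_arg Y S) (lpk_arg Z T) (des_arg Y S) (des_arg Z T)"
    unfolding Us_def Ut_def unbarred_top_fps_S unbarred_top_fps_T
      lpk_des_poly_eq_sum sum_distrib_left by (simp only: mult_ac)
  finally have "lhs_term n = fps_const H * X ^ n"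
    unfolding lhs_term_def
    by (intro arg_cong[where f = "\<lambda>f. f * X ^ n"] fps3_divide_eqI)
      (simp_all only: denominator_simps)
  moreover have "H $ b $ c = coefficient n b c"
    by (simp add: H_def Us_def Ut_def coefficient_def unbarred_top_fps_def super_Cauchy_sum_def
        alternating_weight_fps_const super_fundamental_fps_const fps_sum_nth)
  ultimately show ?thesis by (auto simp: X_eq fps_X_power_mult_right_nth)
qed

lemma rhs_term_nth: "rhs_term k $ a $ b $ c = (if k = (c, b) then coefficient a b c else 0)"
proof -
  obtain i j where k: "k = (i, j)" by force
  let ?C = "Abs_fps (\<lambda>n. fps_const (fps_const (coefficient n j i)))"
  have "(1 + Y * X) ^ (i * (j + 1)) * (1 + Z * X) ^ ((i + 1) * j)
      / ((1 - Y * Z * X) ^ (i * j) * (1 - X) ^ ((i + 1) * (j + 1))) = ?C"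
    using alternating_Cauchy_identity[of "fps_const (fps_const y)" "fps_const (fps_const z)" i j]
    by (intro fps3_divide_eqI, simp only: denominator_simps)
      (simp add: Y_eq Z_eq X_eq coefficient_def alternating_weight_fps_const
        super_Cauchy_sum_fps_const mult_ac)
  then have "rhs_term k = ?C * S ^ i * T ^ j" by (simp only: rhs_term_def k prod.case)
  moreover have "S ^ i = fps_const (fps_const (fps_X ^ i))" "T ^ j = fps_const (fps_X ^ j)"
    by (simp_all add: S_eq T_eq fps_const_power)
  ultimately show ?thesis by (auto simp: k fps_X_power_mult_right_nth)
qed

theorem lpk_des_generating_function:
  "fps3_summable lhs_term {1..} \<and> fps3_summable rhs_term UNIV \<and>
    1 / ((1 - S) * (1 - T)) + fps3_sum lhs_term {1..} = fps3_sum rhs_term UNIV"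
proof -
  note lhs = fps3_summable_single[of lhs_term "\<lambda>a b c. a" coefficient, OF lhs_term_nth]
  note rhs = fps3_summable_single[of rhs_term "\<lambda>a b c. (c, b)" coefficient, OF rhs_term_nth]
  have "lhs_term 0 = 1 / ((1 - S) * (1 - T))"
    by (simp add: lhs_term_def lpk_des_poly_eq_sum left_peak_count_def descent_count_def)
  then have "(1 / ((1 - S) * (1 - T))) $ a $ b $ c = (if a = 0 then coefficient a b c else 0)"
    for a b c
    by (metis lhs_term_nth)
  then have "1 / ((1 - S) * (1 - T)) + fps3_sum lhs_term {1..} = fps3_sum rhs_term UNIV"
    by (intro fps_ext) (simp add: lhs(2) rhs(2))
  then show ?thesis using lhs(1) rhs(1) by blast
qed

end

theorem theorem4p1:
  fixes lhs_term :: "nat \<Rightarrow> series" and rhs_term :: "nat \<times> nat \<Rightarrow> series"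
  defines "lhs_term \<equiv> (\<lambda>n.
      (1 + var_y * var_s) ^ n * (1 + var_z * var_t) ^ n
        * lpk_des_poly n
            ((1 + var_y)\<^sup>2 * var_s / ((var_y + var_s) * (1 + var_y * var_s)))
            ((1 + var_z)\<^sup>2 * var_t / ((var_z + var_t) * (1 + var_z * var_t)))
            ((var_y + var_s) / (1 + var_y * var_s))
            ((var_z + var_t) / (1 + var_z * var_t))
        / ((1 - var_s) ^ (n + 1) * (1 - var_t) ^ (n + 1))
        * var_x ^ n)"
    and "rhs_term \<equiv> (\<lambda>(i, j).
      (1 + var_y * var_x) ^ (i * (j + 1)) * (1 + var_z * var_x) ^ ((i + 1) * j)
        / ((1 - var_y * var_z * var_x) ^ (i * j) * (1 - var_x) ^ ((i + 1) * (j + 1)))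
        * var_s ^ i * var_t ^ j)"
  shows "fps3_summable lhs_term {1..} \<and> fps3_summable rhs_term UNIV \<and>
    1 / ((1 - var_s) * (1 - var_t)) + fps3_sum lhs_term {1..} = fps3_sum rhs_term UNIV"
proof -
  interpret series_variables "to_fract [:[:0, 1:]:]" "to_fract [:0, 1:]"
    var_y var_z var_s var_t var_x
    by unfold_locales (simp_all add: var_y_def var_z_def var_s_def var_t_def var_x_def)
  have "lhs_term = series_variables.lhs_term var_y var_z var_s var_t var_x"
    by (rule ext) (simp only: assms(1) lhs_term_def lpk_arg_def des_arg_def)
  moreover have "rhs_term = series_variables.rhs_term var_y var_z var_s var_t var_x"
    by (simp only: assms(2) rhs_term_def)
  ultimately show ?thesis using lpk_des_generating_function by simp
qed

end
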